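(* Let $a$ be a positive odd integer, let $k,m$ be nonnegative integers and let $n$ be a positive integer. Then $$t(a,3a,8k+2,8m+6;n)=\frac 23N(a,3a,8k+2,8m+6;8n+8k+8m+4a+8)-2N(a,3a,8k+2,8m+6;2n+2k+2m+a+2).$$
   Context: For positive integers $a,b,c,d$ and a nonnegative integer $n$, $N(a,b,c,d;n)$ denotes the number of $(x,y,z,w)\in\mathbb Z^4$ with $n=ax^2+by^2+cz^2+dw^2$, and $t(a,b,c,d;n)$ denotes the number of $(x,y,z,w)\in\mathbb Z^4$ with $n=a\frac{x(x-1)}2+b\frac{y(y-1)}2+c\frac{z(z-1)}2+d\frac{w(w-1)}2$. *)

theory Defs
  imports Complex_Main
begin

text \<open>For positive coefficients the sets below are finite, so \<open>card\<close> is the true number of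
  representations. The integer division by 2 is exact, since \<open>x * (x - 1)\<close> is even.\<close>

definition N_rep :: "nat \<Rightarrow> nat \<Rightarrow> nat \<Rightarrow> nat \<Rightarrow> nat \<Rightarrow> nat" where
  "N_rep a b c d n = card {(x, y, z, w).
     int n = int a * x\<^sup>2 + int b * y\<^sup>2 + int c * z\<^sup>2 + int d * w\<^sup>2}"

definition t_rep :: "nat \<Rightarrow> nat \<Rightarrow> nat \<Rightarrow> nat \<Rightarrow> nat \<Rightarrow> nat" where
  "t_rep a b c d n = card {(x, y, z, w).
     int n = int a * (x * (x - 1) div 2) + int b * (y * (y - 1) div 2)
           + int c * (z * (z - 1) div 2) + int d * (w * (w - 1) div 2)}"

end

theory Submission
  imports Defs "HOL-Library.FuncSet"
begin

text \<open>Multiplying by 8 and completing squares, \<open>t\<close> counts the representations of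
  \<open>M = 8n + 8k + 8m + 4a + 8\<close> by the quaternary form with all four variables odd. In any
  representation of \<open>M\<close>, reduction mod 4 shows that \<open>x, y\<close> have equal parity and so do \<open>z, w\<close>;
  moreover \<open>a(x\<^sup>2 + 3y\<^sup>2)\<close> is 4 mod 8. For odd \<open>u\<close>, the equation \<open>x\<^sup>2 + 3y\<^sup>2 = 4u\<close> has twice as many
  odd solutions as even ones, via multiplication of \<open>x + y\<surd>(-3)\<close>
  by \<open>1 \<plusminus> \<surd>(-3)\<close>. So with \<open>OO, EO, OE, EE\<close> the
  numbers of representations in the four parity classes, \<open>OO = 2 EO\<close> and \<open>OE = 2 EE\<close>, while
  \<open>EE\<close> counts the representations of \<open>M/4\<close>.\<close>

text \<open>For odd \<open>x\<close>, \<open>y\<close> exactly one of \<open>x - y\<close>,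
  \<open>x + y\<close> is divisible by 4, and \<open>y \<rightarrow> - y\<close> swaps the two
  cases. The solutions with \<open>4 dvd x - y\<close> are exactly the multiples by 1 + \<surd>(-3)
  of the pairs in the second set; this factor has norm 4.\<close>

lemma card_odd_pairs:
  fixes a :: int and g :: "'b \<Rightarrow> 'c \<Rightarrow> int"
  shows "card {(x, y, z, w). odd x \<and> odd y \<and> Q z w \<and> a * (x\<^sup>2 + 3 * y\<^sup>2) = g z w} =
    2 * card {(x, y, z, w). odd (x + y) \<and> Q z w \<and> 4 * a * (x\<^sup>2 + 3 * y\<^sup>2) = g z w}"
    (is "card ?A = 2 * card ?B")
proof -
  define A1 where "A1 = {p \<in> ?A. case p of (x, y, z, w) \<Rightarrow> 4 dvd x - y}"
  define A2 where "A2 = {p \<in> ?A. case p of (x, y, z, w) \<Rightarrow> 4 dvd x + y}"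
  have 1: "bij_betw (\<lambda>(x, y, z, w). (x, - y, z, w)) A1 A2"
    by (rule bij_betwI[where g = "\<lambda>(x, y, z, w). (x, - y, z, w)"]) (auto simp: A1_def A2_def)
  \<comment> \<open>The forward map is multiplication of x + y\<surd>(-3) by 1 + \<surd>(-3). Its
    inverse multiplies by the conjugate 1 - \<surd>(-3) and divides by 4, which is exact when
    \<open>4 dvd x - y\<close>.\<close>
  have 2: "bij_betw (\<lambda>(x, y, z, w). (x - 3 * y, x + y, z, w)) ?B A1"
  proof (rule bij_betwI[where g = "\<lambda>(x, y, z, w). ((x + 3 * y) div 4, (y - x) div 4, z, w)"])
    show "(\<lambda>(x, y, z, w). (x - 3 * y, x + y, z, w)) \<in> ?B \<rightarrow> A1"
      by (auto simp: A1_def power2_eq_square algebra_simps)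
    show "(\<lambda>(x, y, z, w). ((x + 3 * y) div 4, (y - x) div 4, z, w)) \<in> A1 \<rightarrow> ?B"
    proof
      fix p assume "p \<in> A1"
      then obtain x y z w where p: "p = (x, y, z, w)" and o: "odd x" "odd y" and q: "Q z w"
        and e: "a * (x\<^sup>2 + 3 * y\<^sup>2) = g z w" and d: "4 dvd x - y"
        by (auto simp: A1_def)
      from d obtain t where "x - y = 4 * t" by (rule dvdE)
      then have x: "x = y + 4 * t" by simp
      have *: "(x + 3 * y) div 4 = y + t" "(y - x) div 4 = - t" by (simp_all add: x)
      have "4 * a * ((y + t)\<^sup>2 + 3 * (- t)\<^sup>2) = a * (x\<^sup>2 + 3 * y\<^sup>2)"
        by (simp add: x power2_eq_square algebra_simps)
      then show "(case p of (x, y, z, w) \<Rightarrow> ((x + 3 * y) div 4, (y - x) div 4, z, w)) \<in> ?B"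
        using o q e by (simp add: p *)
    qed
    show "(\<lambda>(x, y, z, w). (x - 3 * y, x + y, z, w))
        ((\<lambda>(x, y, z, w). ((x + 3 * y) div 4, (y - x) div 4, z, w)) p) = p" if "p \<in> A1" for p
    proof -
      from that obtain x y z w where p: "p = (x, y, z, w)" and d: "4 dvd x - y"
        by (auto simp: A1_def)
      from d obtain t where "x - y = 4 * t" by (rule dvdE)
      then have x: "x = y + 4 * t" by simp
      have "(x + 3 * y) div 4 = y + t" "(y - x) div 4 = - t" by (simp_all add: x)
      then show ?thesis using x by (simp add: p)
    qed
  qed auto
  have "?A = A1 \<union> A2"
  proof -
    have "4 dvd x - y \<or> 4 dvd x + y" if "odd x" "odd y" for x y :: int
      using that by presburger
    then show ?thesis by (auto simp: A1_def A2_def)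
  qed
  moreover have "A1 \<inter> A2 = {}"
  proof -
    have False if "odd x" "4 dvd x - y" "4 dvd x + y" for x y :: int
      using that by presburger
    then show ?thesis by (auto simp: A1_def A2_def)
  qed
  \<comment> \<open>Nothing forces the sets to be finite here; if they are infinite, all the
    cardinalities are 0 and the sum formula still holds.\<close>
  moreover have "finite A1 \<longleftrightarrow> finite A2" using 1 by (rule bij_betw_finite)
  ultimately have "card ?A = card A1 + card A2"
    by (cases "finite A1") (simp_all add: card_Un_disjoint)
  then show ?thesis
    using bij_betw_same_card[OF 1] bij_betw_same_card[OF 2] by simp
qed

text \<open>Halving \<open>x\<close> and \<open>y\<close> maps into the same set as in
  \<open>card_odd_pairs\<close>, so both parity classes are compared with one count. The assumption
  supplies the opposite parity of the halves.\<close>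

lemma card_even_pairs:
  fixes a :: int and g :: "'b \<Rightarrow> 'c \<Rightarrow> int"
  assumes "\<And>x y z w. Q z w \<Longrightarrow> 4 * a * (x\<^sup>2 + 3 * y\<^sup>2) = g z w \<Longrightarrow> odd (x + y)"
  shows "card {(x, y, z, w). even x \<and> even y \<and> Q z w \<and> a * (x\<^sup>2 + 3 * y\<^sup>2) = g z w} =
    card {(x, y, z, w). odd (x + y) \<and> Q z w \<and> 4 * a * (x\<^sup>2 + 3 * y\<^sup>2) = g z w}"
    (is "card ?A = card ?B")
proof -
  have "bij_betw (\<lambda>(x, y, z, w). (2 * x, 2 * y, z, w)) ?B ?A"
  proof (rule bij_betwI[where g = "\<lambda>(x, y, z, w). (x div 2, y div 2, z, w)"])
    show "(\<lambda>(x, y, z, w). (x div 2, y div 2, z, w)) \<in> ?A \<rightarrow> ?B"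
    proof
      fix p assume "p \<in> ?A"
      then obtain x y z w where p: "p = (2 * x, 2 * y, z, w)" and q: "Q z w"
        and e: "a * ((2 * x)\<^sup>2 + 3 * (2 * y)\<^sup>2) = g z w"
        by (auto elim!: evenE)
      have "4 * a * (x\<^sup>2 + 3 * y\<^sup>2) = g z w"
        using e by (simp add: power_mult_distrib algebra_simps)
      with q assms show "(case p of (x, y, z, w) \<Rightarrow> (x div 2, y div 2, z, w)) \<in> ?B"
        by (simp add: p)
    qed
  qed (auto simp: power_mult_distrib algebra_simps)
  then show ?thesis by (simp add: bij_betw_same_card)
qed

lemma odd_square_cong_1_mod_8:
  fixes x :: int
  assumes "odd x"
  obtains j where "x\<^sup>2 = 8 * j + 1"
proof -
  from assms obtain i where i: "x = 2 * i + 1" by (rule oddE)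
  have "even (i * (i + 1))" by simp
  then obtain j where "i * (i + 1) = 2 * j" by (rule evenE)
  then have "x\<^sup>2 = 8 * j + 1" by (simp add: i power2_eq_square algebra_simps)
  then show thesis by (rule that)
qed

text \<open>The map \<open>x \<rightarrow> 2 * x - 1\<close> is a bijection from the integers to the
  odd integers, and its square is 8 times the triangular number plus 1.\<close>

lemma t_rep_eq_card_odd:
  "t_rep a b c d n = card {(x, y, z, w). odd x \<and> odd y \<and> odd z \<and> odd w \<and>
     int (8 * n + a + b + c + d) =
       int a * x\<^sup>2 + int b * y\<^sup>2 + int c * z\<^sup>2 + int d * w\<^sup>2}"
    (is "_ = card ?O")
proof -
  let ?T = "{(x, y, z, w). int n = int a * (x * (x - 1) div 2) + int b * (y * (y - 1) div 2)
           + int c * (z * (z - 1) div 2) + int d * (w * (w - 1) div 2)}"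
  have sq: "(2 * x - 1)\<^sup>2 = 8 * (x * (x - 1) div 2) + 1" for x :: int
  proof -
    have "2 * (x * (x - 1) div 2) = x * (x - 1)" by simp
    moreover have "(2 * x - 1)\<^sup>2 = 4 * (x * (x - 1)) + 1"
      by (simp add: power2_eq_square algebra_simps)
    ultimately show ?thesis by linarith
  qed
  \<comment> \<open>The variables stand for the triangular numbers, kept as atoms; afterwards
    \<open>sq\<close> turns each \<open>8 * X + 1\<close> back into an odd square.\<close>
  have eq: "int n = int a * X + int b * Y + int c * Z + int d * W \<longleftrightarrow>
      int (8 * n + a + b + c + d) = int a * (8 * X + 1) + int b * (8 * Y + 1)
        + int c * (8 * Z + 1) + int d * (8 * W + 1)" for X Y Z W
  proof -
    define S where "S = int a * X + int b * Y + int c * Z + int d * W"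
    have eq: "int a * (8 * X + 1) + int b * (8 * Y + 1) + int c * (8 * Z + 1) + int d * (8 * W + 1) =
        8 * S + int (a + b + c + d)"
      by (simp add: S_def algebra_simps)
    show ?thesis unfolding eq S_def[symmetric] by simp
  qed
  have "bij_betw (\<lambda>(x, y, z, w). (2 * x - 1, 2 * y - 1, 2 * z - 1, 2 * w - 1)) ?T ?O"
  proof (rule bij_betwI[where
      g = "\<lambda>(x, y, z, w). ((x + 1) div 2, (y + 1) div 2, (z + 1) div 2, (w + 1) div 2)"])
    show "(\<lambda>(x, y, z, w). (2 * x - 1, 2 * y - 1, 2 * z - 1, 2 * w - 1)) \<in> ?T \<rightarrow> ?O"
      unfolding eq sq[symmetric] by auto
    show "(\<lambda>(x, y, z, w). ((x + 1) div 2, (y + 1) div 2, (z + 1) div 2, (w + 1) div 2)) \<in> ?O \<rightarrow> ?T"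
      unfolding eq sq[symmetric] by (auto simp: odd_two_times_div_two_succ add.commute[of 1])
  qed (auto simp: odd_two_times_div_two_succ add.commute[of 1])
  then show ?thesis by (simp add: t_rep_def bij_betw_same_card)
qed

text \<open>Every term is nonnegative and bounds the absolute value of its own variable, so all
  variables lie in \<open>{-n..n}\<close>. Finiteness allows the cardinalities of the parity classes
  to be added.\<close>

lemma finite_representations:
  fixes a b c d n :: int
  assumes "a > 0" "b > 0" "c > 0" "d > 0"
  shows "finite {(x, y, z, w). n = a * x\<^sup>2 + b * y\<^sup>2 + c * z\<^sup>2 + d * w\<^sup>2}"
proof -
  have le: "\<bar>x\<bar> \<le> e * x\<^sup>2" if "e > 0" for e x :: int
  proof -
    have "\<bar>x\<bar> * 1 \<le> \<bar>x\<bar> * \<bar>x\<bar>" by (cases "x = 0") (simp, intro mult_left_mono, auto)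
    then have "\<bar>x\<bar> \<le> x\<^sup>2" by (simp add: power2_eq_square)
    also have "\<dots> \<le> e * x\<^sup>2" using that by (simp add: mult_le_cancel_right1)
    finally show ?thesis .
  qed
  have "{(x, y, z, w). n = a * x\<^sup>2 + b * y\<^sup>2 + c * z\<^sup>2 + d * w\<^sup>2}
      \<subseteq> {-n..n} \<times> {-n..n} \<times> {-n..n} \<times> {-n..n}"
  proof
    fix p
    assume "p \<in> {(x, y, z, w). n = a * x\<^sup>2 + b * y\<^sup>2 + c * z\<^sup>2 + d * w\<^sup>2}"
    then obtain x y z w where p: "p = (x, y, z, w)"
      and "n = a * x\<^sup>2 + b * y\<^sup>2 + c * z\<^sup>2 + d * w\<^sup>2" by blast
    with le[OF assms(1), of x] le[OF assms(2), of y] le[OF assms(3), of z] le[OF assms(4), of w]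
    have "\<bar>x\<bar> \<le> n \<and> \<bar>y\<bar> \<le> n \<and> \<bar>z\<bar> \<le> n \<and> \<bar>w\<bar> \<le> n" by linarith
    then show "p \<in> {-n..n} \<times> {-n..n} \<times> {-n..n} \<times> {-n..n}" by (auto simp: p)
  qed
  then show ?thesis by (rule finite_subset) auto
qed

text \<open>Modulo 2 only \<open>a * (x\<^sup>2 + 3 * y\<^sup>2)\<close> survives, so
  \<open>x\<close> and \<open>y\<close> have equal parity. Then 4 divides
  \<open>x\<^sup>2 + 3 * y\<^sup>2\<close>, and reduction modulo 4 leaves
  \<open>2 * (z\<^sup>2 + 3 * w\<^sup>2)\<close>.\<close>

lemma parity_of_representation:
  fixes a k m l x y z w :: int
  assumes "8 * l + 4 * a =
    a * x\<^sup>2 + 3 * a * y\<^sup>2 + (8 * k + 2) * z\<^sup>2 + (8 * m + 6) * w\<^sup>2" and "odd a"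
  shows "even x \<longleftrightarrow> even y" and "even z \<longleftrightarrow> even w"
proof -
  have "even (8 * l + 4 * a)" by simp
  then have "even (a * x\<^sup>2 + 3 * a * y\<^sup>2 + (8 * k + 2) * z\<^sup>2 + (8 * m + 6) * w\<^sup>2)"
    by (simp only: assms(1))
  then show xy: "even x \<longleftrightarrow> even y" using \<open>odd a\<close> by simp
  have "4 dvd x\<^sup>2 + 3 * y\<^sup>2"
  proof (cases "even x")
    case True
    then show ?thesis using xy by (auto elim!: evenE simp: power_mult_distrib)
  next
    case False
    obtain i where i: "x\<^sup>2 = 8 * i + 1" using False by (rule odd_square_cong_1_mod_8)
    obtain j where j: "y\<^sup>2 = 8 * j + 1" using False xy by (auto elim: odd_square_cong_1_mod_8)
    show ?thesis unfolding i j by presburger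
  qed
  then obtain s where s: "x\<^sup>2 + 3 * y\<^sup>2 = 4 * s" by (rule dvdE)
  have "a * x\<^sup>2 + 3 * a * y\<^sup>2 = a * (x\<^sup>2 + 3 * y\<^sup>2)" by (simp add: algebra_simps)
  then have "a * x\<^sup>2 + 3 * a * y\<^sup>2 = 4 * (a * s)" using s by simp
  with assms(1) have "z\<^sup>2 + w\<^sup>2 = 2 * (2 * l + a - a * s - 2 * (k * z\<^sup>2) - 2 * (m * w\<^sup>2) - w\<^sup>2)"
    by (simp add: algebra_simps)
  then have "even (z\<^sup>2 + w\<^sup>2)" by (metis dvd_triv_left)
  then show "even z \<longleftrightarrow> even w" by simp
qed

theorem theorem2p2:
  fixes a k m n :: nat
  assumes "a > 0" and "odd a" and "n > 0"
  shows "real (t_rep a (3 * a) (8 * k + 2) (8 * m + 6) n) =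
    2 / 3 * real (N_rep a (3 * a) (8 * k + 2) (8 * m + 6) (8 * n + 8 * k + 8 * m + 4 * a + 8))
    - 2 * real (N_rep a (3 * a) (8 * k + 2) (8 * m + 6) (2 * n + 2 * k + 2 * m + a + 2))"
proof -
  define A C D where "A = int a" and "C = int (8 * k + 2)" and "D = int (8 * m + 6)"
  define M L where "M = 8 * n + 8 * k + 8 * m + 4 * a + 8" and "L = 2 * n + 2 * k + 2 * m + a + 2"
  define g where "g z w = int M - C * z\<^sup>2 - D * w\<^sup>2" for z w :: int
  \<comment> \<open>The parity classes: \<open>P\<close> is the parity of \<open>x\<close>,
    \<open>y\<close> and \<open>Q\<close> that of \<open>z\<close>, \<open>w\<close>. Below,
    \<open>B Q\<close> is the common yardstick for \<open>R odd Q\<close> and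
    \<open>R even Q\<close>.\<close>
  define R where "R P Q = {(x, y, z, w). P x \<and> P y \<and> (Q z \<and> Q w) \<and> A * (x\<^sup>2 + 3 * y\<^sup>2) = g z w}"
    for P Q :: "int \<Rightarrow> bool"
  define B where "B Q = {(x, y, z, w). odd (x + y) \<and> (Q z \<and> Q w) \<and> 4 * A * (x\<^sup>2 + 3 * y\<^sup>2) = g z w}"
    for Q :: "int \<Rightarrow> bool"
  have "odd A" using assms by (simp add: A_def)
  have M_eq: "int M = int (8 * n + a + 3 * a + (8 * k + 2) + (8 * m + 6))" by (simp add: M_def)
  have M_eq_4L: "int M = 4 * int L" by (simp add: M_def L_def)
  have form: "int M = int a * x\<^sup>2 + int (3 * a) * y\<^sup>2 + int (8 * k + 2) * z\<^sup>2 + int (8 * m + 6) * w\<^sup>2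
      \<longleftrightarrow> A * (x\<^sup>2 + 3 * y\<^sup>2) = g z w" for x y z w
    unfolding g_def A_def C_def D_def by (auto simp: algebra_simps)

  \<comment> \<open>Here \<open>M\<close> is \<open>4 * A\<close> modulo 8, and
    \<open>C * z\<^sup>2 + D * w\<^sup>2\<close> vanishes modulo 8: for even \<open>z\<close>,
    \<open>w\<close> because \<open>C\<close> and \<open>D\<close> are even, for odd ones because
    the residues 2 and 6 add up to 8.\<close>
  have g_cong: "\<exists>j. g z w = 4 * A + 8 * j" if "even z \<and> even w \<or> odd z \<and> odd w" for z w
    using that
  proof
    assume "even z \<and> even w"
    then obtain z' w' where "z = 2 * z'" "w = 2 * w'" by (auto elim!: evenE)
    then have "g z w = 4 * A + 8 * (n + k + m + 1 - (4 * k + 1) * z'\<^sup>2 - (4 * m + 3) * w'\<^sup>2)"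
      by (simp add: g_def M_def A_def C_def D_def power_mult_distrib algebra_simps)
    then show ?thesis by blast
  next
    assume "odd z \<and> odd w"
    then obtain i j where "z\<^sup>2 = 8 * i + 1" "w\<^sup>2 = 8 * j + 1"
      using odd_square_cong_1_mod_8 by metis
    then have "g z w = 4 * A + 8 * (n - (8 * k + 2) * i - (8 * m + 6) * j)"
      by (simp add: g_def M_def A_def C_def D_def algebra_simps)
    then show ?thesis by blast
  qed
  have odd_sum: "odd (x + y)"
    if zw: "even z \<and> even w \<or> odd z \<and> odd w" and e: "4 * A * (x\<^sup>2 + 3 * y\<^sup>2) = g z w" for x y z w
  proof -
    obtain j where "g z w = 4 * A + 8 * j" using g_cong[OF zw] by blast
    with e have "4 * (A * (x\<^sup>2 + 3 * y\<^sup>2)) = 4 * (A + 2 * j)" by (simp add: algebra_simps)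
    then have "A * (x\<^sup>2 + 3 * y\<^sup>2) = A + 2 * j" by simp
    then have "odd (A * (x\<^sup>2 + 3 * y\<^sup>2))" using \<open>odd A\<close> by simp
    then show ?thesis by simp
  qed

  have OO: "card (R odd odd) = 2 * card (B odd)" and OE: "card (R odd even) = 2 * card (B even)"
    unfolding R_def B_def by (rule card_odd_pairs)+
  have EO: "card (R even odd) = card (B odd)" and EE: "card (R even even) = card (B even)"
    unfolding R_def B_def by (rule card_even_pairs; use odd_sum in blast)+

  have t: "t_rep a (3 * a) (8 * k + 2) (8 * m + 6) n = card (R odd odd)"
    unfolding t_rep_eq_card_odd M_eq[symmetric] form R_def by (simp add: conj_assoc)

  have NL: "N_rep a (3 * a) (8 * k + 2) (8 * m + 6) L = card (B even)"
  proof -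
    let ?N = "{(x, y, z, w). int L = int a * x\<^sup>2 + int (3 * a) * y\<^sup>2
      + int (8 * k + 2) * z\<^sup>2 + int (8 * m + 6) * w\<^sup>2}"
    \<comment> \<open>Multiply by 4, using \<open>M = 4 * L\<close>: the factor is absorbed into
      \<open>z\<close> and \<open>w\<close> by doubling them but stays explicit for \<open>x\<close>
      and \<open>y\<close>, as in \<open>B even\<close>.\<close>
    have formL: "int L = int a * x\<^sup>2 + int (3 * a) * y\<^sup>2 + int (8 * k + 2) * z\<^sup>2 + int (8 * m + 6) * w\<^sup>2
      \<longleftrightarrow> 4 * A * (x\<^sup>2 + 3 * y\<^sup>2) = g (2 * z) (2 * w)" for x y z w
      unfolding g_def A_def C_def D_def M_eq_4L by (auto simp: power_mult_distrib algebra_simps)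
    have "bij_betw (\<lambda>(x, y, z, w). (x, y, 2 * z, 2 * w)) ?N (B even)"
    proof (rule bij_betwI[where g = "\<lambda>(x, y, z, w). (x, y, z div 2, w div 2)"])
      have "odd (x + y)" if "4 * A * (x\<^sup>2 + 3 * y\<^sup>2) = g (2 * z) (2 * w)" for x y z w
        using odd_sum[OF _ that] by simp
      then show "(\<lambda>(x, y, z, w). (x, y, 2 * z, 2 * w)) \<in> ?N \<rightarrow> B even"
        unfolding formL B_def by (auto simp del: even_add)
      show "(\<lambda>(x, y, z, w). (x, y, z div 2, w div 2)) \<in> B even \<rightarrow> ?N"
        unfolding formL B_def by auto
    qed (auto simp: B_def)
    then show ?thesis by (simp add: N_rep_def bij_betw_same_card)
  qed

  have NM: "N_rep a (3 * a) (8 * k + 2) (8 * m + 6) M =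
      card (R odd odd) + card (R odd even) + card (R even odd) + card (R even even)"
  proof -
    let ?N = "{(x, y, z, w). int M = int a * x\<^sup>2 + int (3 * a) * y\<^sup>2
      + int (8 * k + 2) * z\<^sup>2 + int (8 * m + 6) * w\<^sup>2}"
    \<comment> \<open>This excludes mixed parities, so the four classes exhaust all representations
      of \<open>M\<close>.\<close>
    have par: "(even x \<longleftrightarrow> even y) \<and> (even z \<longleftrightarrow> even w)" if "A * (x\<^sup>2 + 3 * y\<^sup>2) = g z w" for x y z w
    proof -
      have "8 * int (n + k + m + 1) + 4 * A =
          A * x\<^sup>2 + 3 * A * y\<^sup>2 + (8 * int k + 2) * z\<^sup>2 + (8 * int m + 6) * w\<^sup>2"
        using that by (simp add: g_def M_def A_def C_def D_def algebra_simps)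
      from parity_of_representation[OF this \<open>odd A\<close>] show ?thesis by blast
    qed
    have split: "?N = (R odd odd \<union> R odd even) \<union> (R even odd \<union> R even even)"
      unfolding form R_def using par by auto
    have fin: "finite ?N" using assms by (intro finite_representations) auto
    have "finite (R odd odd)" "finite (R odd even)" "finite (R even odd)" "finite (R even even)"
      using fin unfolding split by auto
    moreover have "R odd odd \<inter> R odd even = {}" "R even odd \<inter> R even even = {}"
      "(R odd odd \<union> R odd even) \<inter> (R even odd \<union> R even even) = {}"
      unfolding R_def by auto
    ultimately have "card ?N =
        card (R odd odd) + card (R odd even) + card (R even odd) + card (R even even)"
      unfolding split by (simp add: card_Un_disjoint)
    then show ?thesis by (simp only: N_rep_def)
  qed
  show ?thesis
    \<comment> \<open>With p and q the cardinalities of \<open>B odd\<close> and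
      \<open>B even\<close>, the claim reads 2p = (2/3)(3p + 3q) - 2q.\<close>
    unfolding t NM[unfolded M_def] NL[unfolded L_def] OO OE EO EE by (simp add: field_simps)
qed

end
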